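(* A voxel $p(i,j,k)\in\mathbb Z^3$ belongs to an absentee circle if and only if $i^2\in I_{r'-k}^{(r')}$ for some $r'\in\mathbb Z^+$ such that $r'^2\in J_{r''-j}^{(r'')}$ for some $r''\in\mathbb Z^+$.
   Context: Intervals (of integers): for integers $\rho,k$, $I_{\rho-k}^{(\rho)}=[\rho^2-k^2-k,\ \rho^2-k^2+k)$ and $J_{\rho-k}^{(\rho)}=[\rho^2-k^2+k,\ (\rho+1)^2-k^2-k)$. Digital circle of integer radius $r\ge 0$: $\mathcal C^{\mathbb Z}(r)=\{(i,j)\in\mathbb Z^2: |\max(|i|,|j|)-\sqrt{r^2-\min(|i|,|j|)^2}|<\tfrac12\}$ (points for which the square root is not real are excluded). Digital disc: $\mathcal D^{\mathbb Z}(r)$ is the set of all $(i,j_c)\in\mathbb Z^2$ for which there is $(i_c,j_c)\in\mathcal C^{\mathbb Z}(r)$ with $i$ between $0$ and $i_c$ inclusive. A pixel is a disc absentee if it belongs to $\mathcal D^{\mathbb Z}(r)\setminus\bigcup_{s=0}^{r}\mathcal C^{\mathbb Z}(s)$ for some $r$. Coordinates in $\mathbb Z^3$ are $(x,y,z)$. For each disc absentee $(a,b)$ in the first quadrant of the $xy$-plane, the corresponding absentee circle is $\mathbf C_{(a,b)}=\{(i',b,k')\in\mathbb Z^3: (i',k')\in\mathcal C^{\mathbb Z}(a)\}$, i.e. the digital circle of radius $a$ with center $(0,b,0)$ in the plane $y=b$.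
   Formalization: The literal claim fails, e.g. at (0,0,1), (2,2,2), (1,1,0); proved for all voxels with j≥0 added and (i,k), (r',j) replaced by (min,max) of (|i|,|k|) and of (r',j), and verbatim when 0≤i≤k and every r' with i² in its I-interval is ≤ j. *)

theory Defs
  imports Complex_Main
begin

text \<open>
  Both families are indexed by the radius \<open>\<rho>\<close> (upper index) and by the run number \<open>m = \<rho> - k\<close>
  (lower index); the lemmas below give the intervals in terms of \<open>k\<close>.
\<close>

definition I_intv :: "int \<Rightarrow> int \<Rightarrow> int set" where
  "I_intv \<rho> m = (let k = \<rho> - m in {\<rho>^2 - k^2 - k ..< \<rho>^2 - k^2 + k})"

definition J_intv :: "int \<Rightarrow> int \<Rightarrow> int set" where
  "J_intv \<rho> m = (let k = \<rho> - m in {\<rho>^2 - k^2 + k ..< (\<rho> + 1)^2 - k^2 - k})"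

lemma I_intv_run: "I_intv \<rho> (\<rho> - k) = {\<rho>^2 - k^2 - k ..< \<rho>^2 - k^2 + k}"
  by (simp add: I_intv_def)

lemma J_intv_run: "J_intv \<rho> (\<rho> - k) = {\<rho>^2 - k^2 + k ..< (\<rho> + 1)^2 - k^2 - k}"
  by (simp add: J_intv_def)

text \<open>
  The first conjunct excludes the points for which the square root is not real; it is needed
  because \<^const>\<open>sqrt\<close> is total and odd. Radii are integers and only \<open>r \<ge> 0\<close> is meaningful.
\<close>

definition digital_circle :: "int \<Rightarrow> (int \<times> int) set" where
  "digital_circle r =
     {(i, j). (min \<bar>i\<bar> \<bar>j\<bar>)^2 \<le> r^2 \<and>
              \<bar>real_of_int (max \<bar>i\<bar> \<bar>j\<bar>) - sqrt (real_of_int (r^2 - (min \<bar>i\<bar> \<bar>j\<bar>)^2))\<bar> < 1 / 2}"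

definition digital_disc :: "int \<Rightarrow> (int \<times> int) set" where
  "digital_disc r =
     {(i, jc). \<exists>ic. (ic, jc) \<in> digital_circle r \<and> (0 \<le> i \<and> i \<le> ic \<or> ic \<le> i \<and> i \<le> 0)}"

definition disc_absentee :: "int \<times> int \<Rightarrow> bool" where
  "disc_absentee p \<longleftrightarrow> (\<exists>r\<ge>0. p \<in> digital_disc r - (\<Union>s\<in>{0..r}. digital_circle s))"

definition absentee_circle :: "int \<Rightarrow> int \<Rightarrow> (int \<times> int \<times> int) set" where
  "absentee_circle a b = {(i, b, k) | i k. (i, k) \<in> digital_circle a}"

definition absentee_circles :: "(int \<times> int \<times> int) set set" where
  "absentee_circles = {absentee_circle a b | a b. 0 \<le> a \<and> 0 \<le> b \<and> disc_absentee (a, b)}"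

end

theory Submission imports Defs begin

text \<open>
  Membership of a lattice point in a digital circle only depends on its squared norm \<open>N\<close> and its
  maximum norm \<open>M\<close>: the circle of radius \<open>s > 0\<close> takes the points with \<open>s\<^sup>2 - M \<le> N < s\<^sup>2 + M\<close>, which is
  the interval \<open>I\<close> shifted by \<open>M\<^sup>2\<close>. Every point lies in some disc, and a point of the disc of radius
  \<open>r\<close> lies on no circle of radius greater than \<open>r\<close>, so the disc absentees are the points on no circle
  at all. These are the points for which \<open>N\<close> falls into a gap \<open>r\<^sup>2 + M \<le> N < (r + 1)\<^sup>2 - M\<close>,
  which is the interval \<open>J\<close> shifted by \<open>M\<^sup>2\<close>.
\<close>

section \<open>Digital circles in integer arithmetic\<close>

text \<open>Squaring compares \<open>D\<close> with \<open>M^2 - M + 1/4\<close> and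
  \<open>M^2 + M + 1/4\<close>. As \<open>D\<close> is an integer, dropping the 1/4 makes the lower
  bound strict and the upper one weak. For \<open>M = 0\<close> the lower bound is automatic, which
  leaves \<open>D = 0\<close>.\<close>

lemma abs_diff_sqrt_less_half_iff:
  fixes M D :: int
  assumes "0 \<le> M" "0 \<le> D"
  shows "\<bar>real_of_int M - sqrt (real_of_int D)\<bar> < 1 / 2 \<longleftrightarrow>
         (M = 0 \<and> D = 0) \<or> (M^2 - M < D \<and> D \<le> M^2 + M)"
proof -
  define s where "s = sqrt (real_of_int D)"
  have s: "0 \<le> s" "s^2 = real_of_int D"
    using assms by (simp_all add: s_def)
  have "s < M + 1/2 \<longleftrightarrow> s^2 < (M + 1/2)^2"
    by (intro iffI; (rule power_strict_mono | rule power2_less_imp_less); use s(1) assms(1) in simp)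
  also have "\<dots> \<longleftrightarrow> real_of_int D < real_of_int (M^2 + M) + 1/4"
    unfolding s(2) by (simp add: power2_eq_square algebra_simps)
  also have "\<dots> \<longleftrightarrow> D \<le> M^2 + M"
    by linarith
  finally have upper: "s < M + 1/2 \<longleftrightarrow> D \<le> M^2 + M" .
  have lower: "M - 1/2 < s \<longleftrightarrow> M^2 - M < D" if "M \<ge> 1"
  proof -
    have "M - 1/2 < s \<longleftrightarrow> (M - 1/2)^2 < s^2"
      by (intro iffI; (rule power_strict_mono | rule power2_less_imp_less); use s(1) that in simp)
    also have "\<dots> \<longleftrightarrow> real_of_int (M^2 - M) + 1/4 < real_of_int D"
      unfolding s(2) by (simp add: power2_eq_square algebra_simps)
    also have "\<dots> \<longleftrightarrow> M^2 - M < D"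
      by linarith
    finally show ?thesis .
  qed
  have "\<bar>real_of_int M - s\<bar> < 1/2 \<longleftrightarrow> s < M + 1/2 \<and> M - 1/2 < s"
    by linarith
  moreover have "M - 1/2 < s" if "M = 0"
    using s(1) that by simp
  ultimately show ?thesis
    unfolding s_def[symmetric] using upper lower assms by (cases "M = 0") auto
qed

lemma digital_circle_iff:
  "(i, j) \<in> digital_circle r \<longleftrightarrow>
    (r = 0 \<and> i = 0 \<and> j = 0) \<or>
    (r^2 - max \<bar>i\<bar> \<bar>j\<bar> \<le> i^2 + j^2 \<and> i^2 + j^2 < r^2 + max \<bar>i\<bar> \<bar>j\<bar>)"
proof -
  define M m where "M = max \<bar>i\<bar> \<bar>j\<bar>" and "m = min \<bar>i\<bar> \<bar>j\<bar>"
  have M: "0 \<le> m" "m \<le> M" and N: "m^2 + M^2 = i^2 + j^2"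
    by (auto simp: M_def m_def min_def max_def)
  \<comment> \<open>Lets the lower bound \<open>M^2 - M < r^2 - m^2\<close> imply that the square
    root is real.\<close>
  have "M \<le> M^2"
    using M self_le_power[of M 2] by (cases "M = 0") auto
  have zero: "M = 0 \<and> m^2 \<le> r^2 \<and> r^2 - m^2 = 0 \<longleftrightarrow> r = 0 \<and> i = 0 \<and> j = 0"
  proof (cases "M = 0")
    case True
    then show ?thesis
      using M by (auto simp: M_def)
  next
    case False
    then have "\<not> (i = 0 \<and> j = 0)"
      by (auto simp: M_def)
    then show ?thesis
      using False by simp
  qed
  have "(i, j) \<in> digital_circle r \<longleftrightarrow>
      m^2 \<le> r^2 \<and> \<bar>real_of_int M - sqrt (real_of_int (r^2 - m^2))\<bar> < 1/2"
    by (simp only: digital_circle_def M_def m_def mem_Collect_eq case_prod_conv)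
  also have "\<dots> \<longleftrightarrow>
      m^2 \<le> r^2 \<and> ((M = 0 \<and> r^2 - m^2 = 0) \<or> (M^2 - M < r^2 - m^2 \<and> r^2 - m^2 \<le> M^2 + M))"
    by (intro conj_cong refl abs_diff_sqrt_less_half_iff) (use M in linarith)+
  also have "\<dots> \<longleftrightarrow>
      (M = 0 \<and> m^2 \<le> r^2 \<and> r^2 - m^2 = 0) \<or> (r^2 - M \<le> m^2 + M^2 \<and> m^2 + M^2 < r^2 + M)"
    using \<open>M \<le> M^2\<close> by linarith
  finally show ?thesis
    unfolding zero N unfolding M_def .
qed

lemma sum_min_max_squares: "(min a b)^2 + (max a b)^2 = a^2 + (b::int)^2"
  by (auto simp: min_def max_def)

text \<open>Positivity of \<open>r\<close> excludes the origin on the circle of radius 0, where the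
  interval is empty.\<close>

lemma digital_circle_iff_I_intv:
  assumes "0 < r"
  shows "(i, j) \<in> digital_circle r \<longleftrightarrow> (min \<bar>i\<bar> \<bar>j\<bar>)^2 \<in> I_intv r (r - max \<bar>i\<bar> \<bar>j\<bar>)"
proof -
  have "(min \<bar>i\<bar> \<bar>j\<bar>)^2 + (max \<bar>i\<bar> \<bar>j\<bar>)^2 = i^2 + j^2"
    using sum_min_max_squares[of "\<bar>i\<bar>" "\<bar>j\<bar>"] by simp
  then show ?thesis
    using assms unfolding digital_circle_iff I_intv_run atLeastLessThan_iff by linarith
qed

text \<open>If \<open>r \<le> M - 1\<close>, then
  \<open>r^2 + M \<le> M^2 - M + 1 \<le> M^2 \<le> i^2 + j^2\<close>, beyond the upper bound of the
  circle.\<close>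

lemma max_abs_le_radius:
  assumes "(i, j) \<in> digital_circle r" "0 \<le> r"
  shows "max \<bar>i\<bar> \<bar>j\<bar> \<le> r"
proof (rule ccontr)
  define M where "M = max \<bar>i\<bar> \<bar>j\<bar>"
  assume "\<not> max \<bar>i\<bar> \<bar>j\<bar> \<le> r"
  then have "r \<le> M - 1"
    unfolding M_def by linarith
  then have "r^2 \<le> (M - 1)^2"
    using assms(2) by (intro power_mono) auto
  then have "r^2 \<le> M^2 - 2 * M + 1"
    by (simp add: power2_eq_square algebra_simps)
  moreover have "M^2 \<le> i^2 + j^2"
    by (auto simp: M_def max_def)
  ultimately show False
    using assms \<open>r \<le> M - 1\<close> unfolding digital_circle_iff M_def[symmetric] by (auto simp: M_def)
qed

section \<open>Discs and absentees\<close>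

lemma in_some_digital_disc:
  assumes "0 \<le> a" "0 \<le> b"
  obtains r where "0 \<le> r" "(a, b) \<in> digital_disc r"
proof
  \<comment> \<open>Since \<open>r\<close> exceeds \<open>b^2\<close>, the pixel
    \<open>(r, b)\<close> lies on the circle of radius \<open>r\<close>; since
    \<open>a \<le> r\<close>, its row in the disc reaches \<open>(a, b)\<close>.\<close>
  define r where "r = a + b + b^2 + 1"
  show "0 \<le> r"
    using assms by (simp add: r_def)
  have "max \<bar>r\<bar> \<bar>b\<bar> = r" "b^2 < r" "a \<le> r"
    using assms zero_le_power2[of b] unfolding r_def by linarith+
  then have "(r, b) \<in> digital_circle r"
    using \<open>0 \<le> r\<close> zero_le_power2[of b] unfolding digital_circle_iff by linarith
  then show "(a, b) \<in> digital_disc r"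
    using assms \<open>a \<le> r\<close> by (auto simp: digital_disc_def)
qed

text \<open>Otherwise \<open>(r + 1)^2 \<le> s^2 \<le> r^2 + M + M'\<close>, with
  \<open>(c, b)\<close> the circle pixel that bounds the row; but \<open>M\<close> and
  \<open>M'\<close> are at most \<open>r\<close>.\<close>

lemma digital_disc_circle_radius_le:
  assumes disc: "(a, b) \<in> digital_disc r" and circle: "(a, b) \<in> digital_circle s"
    and nonneg: "0 \<le> a" "0 \<le> b" "0 \<le> r" "0 \<le> s"
  shows "s \<le> r"
proof (rule ccontr)
  assume "\<not> s \<le> r"
  then have "(r + 1)^2 \<le> s^2"
    using nonneg by (intro power_mono) auto
  obtain c where c: "(c, b) \<in> digital_circle r" "a \<le> \<bar>c\<bar>"
    using disc unfolding digital_disc_def by force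
  define M M' where "M = max \<bar>a\<bar> \<bar>b\<bar>" and "M' = max \<bar>c\<bar> \<bar>b\<bar>"
  have "M \<le> M'" "M' \<le> r" "0 \<le> M"
    using max_abs_le_radius[OF c(1)] c(2) nonneg by (auto simp: M_def M'_def)
  moreover have "a^2 \<le> c^2"
    using c(2) nonneg by (intro power2_mono) auto
  moreover have "s^2 - M \<le> a^2 + b^2"
    using circle \<open>\<not> s \<le> r\<close> nonneg by (auto simp: digital_circle_iff M_def)
  \<comment> \<open>The weak inequality also covers the circle of radius 0.\<close>
  moreover have "c^2 + b^2 \<le> r^2 + M'"
    using c(1) by (auto simp: digital_circle_iff M'_def)
  moreover have "(r + 1)^2 = r^2 + 2 * r + 1"
    by (simp add: power2_eq_square algebra_simps)
  ultimately show False
    using \<open>(r + 1)^2 \<le> s^2\<close> by linarith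
qed

lemma disc_absentee_iff:
  assumes "0 \<le> a" "0 \<le> b"
  shows "disc_absentee (a, b) \<longleftrightarrow> (\<forall>s\<ge>0. (a, b) \<notin> digital_circle s)"
proof
  assume "disc_absentee (a, b)"
  then obtain r where "0 \<le> r" "(a, b) \<in> digital_disc r" "\<forall>s\<in>{0..r}. (a, b) \<notin> digital_circle s"
    by (auto simp: disc_absentee_def)
  then show "\<forall>s\<ge>0. (a, b) \<notin> digital_circle s"
    using digital_disc_circle_radius_le assms by (meson atLeastAtMost_iff)
next
  assume "\<forall>s\<ge>0. (a, b) \<notin> digital_circle s"
  moreover obtain r where "0 \<le> r" "(a, b) \<in> digital_disc r"
    using in_some_digital_disc[OF assms] .
  ultimately show "disc_absentee (a, b)"
    by (auto simp: disc_absentee_def)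
qed

section \<open>Gaps between consecutive circles\<close>

lemma ex_floor_sqrt:
  fixes n :: int
  assumes "0 \<le> n"
  obtains q where "0 \<le> q" "q^2 \<le> n" "n < (q + 1)^2"
proof
  define q where "q = \<lfloor>sqrt (real_of_int n)\<rfloor>"
  have q: "real_of_int q \<le> sqrt (real_of_int n)" "sqrt (real_of_int n) < real_of_int (q + 1)"
    unfolding q_def by linarith+
  show "0 \<le> q"
    using assms by (simp add: q_def)
  then have "(real_of_int q)^2 \<le> (sqrt (real_of_int n))^2"
    using q by (intro power_mono) auto
  then show "q^2 \<le> n"
    using assms by (simp flip: of_int_power)
  have "(sqrt (real_of_int n))^2 < (real_of_int (q + 1))^2"
    using q assms by (intro power_strict_mono) auto
  then show "n < (q + 1)^2"
    using assms by (simp flip: of_int_power del: of_int_add)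
qed

lemma disc_absentee_iff_J_intv:
  assumes "0 \<le> a" "0 \<le> b"
  shows "disc_absentee (a, b) \<longleftrightarrow> (\<exists>r>0. (min a b)^2 \<in> J_intv r (r - max a b))"
proof -
  define M where "M = max a b"
  have "0 \<le> M"
    using assms by (simp add: M_def)
  have gap_iff: "(min a b)^2 \<in> J_intv r (r - max a b) \<longleftrightarrow>
      r^2 + M \<le> a^2 + b^2 \<and> a^2 + b^2 < (r + 1)^2 - M" for r
    using sum_min_max_squares[of a b] by (auto simp: J_intv_run M_def)
  have circle_iff: "(a, b) \<in> digital_circle s \<longleftrightarrow>
      (s = 0 \<and> a = 0 \<and> b = 0) \<or> (s^2 - M \<le> a^2 + b^2 \<and> a^2 + b^2 < s^2 + M)" for s
    using assms by (simp add: digital_circle_iff M_def)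
  show ?thesis
    unfolding disc_absentee_iff[OF assms] gap_iff
  proof
    assume absent: "\<forall>s\<ge>0. (a, b) \<notin> digital_circle s"
    obtain q where q: "0 \<le> q" "q^2 \<le> a^2 + b^2" "a^2 + b^2 < (q + 1)^2"
      using ex_floor_sqrt[of "a^2 + b^2"] by auto
    \<comment> \<open>Between \<open>q^2\<close> and \<open>(q + 1)^2\<close>, missing circle
      \<open>q\<close> can only mean lying above its window, and missing circle \<open>q + 1\<close>
      lying below its window.\<close>
    have gap: "q^2 + M \<le> a^2 + b^2" "a^2 + b^2 < (q + 1)^2 - M"
      using absent[rule_format, of q] absent[rule_format, of "q + 1"] q \<open>0 \<le> M\<close>
      by (auto simp: circle_iff)
    \<comment> \<open>The gap \<open>M \<le> a^2 + b^2 < 1 - M\<close> leaves only the origin, which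
      is on the circle of radius 0.\<close>
    have "q \<noteq> 0"
    proof
      assume "q = 0"
      then have "M = 0"
        using gap \<open>0 \<le> M\<close> by simp
      then have "a = 0" "b = 0"
        using assms by (simp_all add: M_def max_def split: if_splits)
      then show False
        using absent[rule_format, of 0] circle_iff[of 0] by simp
    qed
    then show "\<exists>r>0. r^2 + M \<le> a^2 + b^2 \<and> a^2 + b^2 < (r + 1)^2 - M"
      using gap q(1) by (intro exI[of _ q]) auto
  next
    assume "\<exists>r>0. r^2 + M \<le> a^2 + b^2 \<and> a^2 + b^2 < (r + 1)^2 - M"
    then obtain r where r: "0 < r" "r^2 + M \<le> a^2 + b^2" "a^2 + b^2 < (r + 1)^2 - M"
      by blast
    have nonzero: "\<not> (a = 0 \<and> b = 0)"
    proof
      assume "a = 0 \<and> b = 0"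
      then have "r^2 + M \<le> 0"
        using r(2) by simp
      then show False
        using r(1) \<open>0 \<le> M\<close> zero_less_power[of r 2] by linarith
    qed
    show "\<forall>s\<ge>0. (a, b) \<notin> digital_circle s"
    proof (intro allI impI)
      fix s :: int
      assume "0 \<le> s"
      \<comment> \<open>No square lies strictly between, so every window ends before the gap or
        starts after it.\<close>
      then have "s^2 \<le> r^2 \<or> (r + 1)^2 \<le> s^2"
        using r(1) by (cases "s \<le> r") (auto intro!: power_mono)
      then show "(a, b) \<notin> digital_circle s"
        using r nonzero unfolding circle_iff by linarith
    qed
  qed
qed

section \<open>Absentee circles\<close>

text \<open>Rules out absentee circles of radius 0, so that the interval form, valid for positive
  radii, applies to all of them.\<close>

lemma not_disc_absentee_0:
  assumes "0 \<le> b"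
  shows "\<not> disc_absentee (0, b)"
proof -
  have "(0, b) \<in> digital_circle b"
    using assms by (auto simp: digital_circle_iff)
  then show ?thesis
    using assms by (auto simp: disc_absentee_iff)
qed

lemma in_absentee_circles_iff:
  "(\<exists>C\<in>absentee_circles. (i, j, k) \<in> C) \<longleftrightarrow>
    0 \<le> j \<and> (\<exists>a>0. (i, k) \<in> digital_circle a \<and> disc_absentee (a, j))"
proof -
  have "(\<exists>C\<in>absentee_circles. (i, j, k) \<in> C) \<longleftrightarrow>
      0 \<le> j \<and> (\<exists>a\<ge>0. (i, k) \<in> digital_circle a \<and> disc_absentee (a, j))"
    by (auto simp: absentee_circles_def absentee_circle_def)
  moreover have "0 \<le> a \<longleftrightarrow> 0 < a" if "0 \<le> j" "disc_absentee (a, j)" for a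
    using not_disc_absentee_0 that by (cases "a = 0") auto
  ultimately show ?thesis
    by blast
qed

text \<open>A run is described in one octant, so arbitrary voxels require \<open>min\<close> and
  \<open>max\<close>. The second conjunct is the region where these disappear from both interval
  conditions.\<close>

theorem theorem8:
  fixes i j k :: int
  shows "((\<exists>C\<in>absentee_circles. (i, j, k) \<in> C) \<longleftrightarrow>
            0 \<le> j \<and>
            (\<exists>r'>0. (min \<bar>i\<bar> \<bar>k\<bar>)^2 \<in> I_intv r' (r' - max \<bar>i\<bar> \<bar>k\<bar>) \<and>
                    (\<exists>r''>0. (min r' j)^2 \<in> J_intv r'' (r'' - max r' j))))
         \<and>
         (0 \<le> i \<and> i \<le> k \<and> (\<forall>r'>0. i^2 \<in> I_intv r' (r' - k) \<longrightarrow> r' \<le> j) \<longrightarrow>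
           ((\<exists>C\<in>absentee_circles. (i, j, k) \<in> C) \<longleftrightarrow>
            (\<exists>r'>0. i^2 \<in> I_intv r' (r' - k) \<and>
                    (\<exists>r''>0. r'^2 \<in> J_intv r'' (r'' - j)))))"
    (is "(?L \<longleftrightarrow> ?R) \<and> (?wedge \<longrightarrow> (?L \<longleftrightarrow> ?R'))")
proof
  show general: "?L \<longleftrightarrow> ?R"
    unfolding in_absentee_circles_iff
    using digital_circle_iff_I_intv disc_absentee_iff_J_intv by (metis less_imp_le)
  show "?wedge \<longrightarrow> (?L \<longleftrightarrow> ?R')"
  proof
    assume wedge: ?wedge
    then have "min \<bar>i\<bar> \<bar>k\<bar> = i" "max \<bar>i\<bar> \<bar>k\<bar> = k"
      by auto
    \<comment> \<open>Here \<open>0 \<le> j\<close> comes from \<open>0 < r' \<le> j\<close>; if no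
      such \<open>r'\<close> exists, both sides are false.\<close>
    moreover have "min r' j = r'" "max r' j = j" "0 \<le> j"
      if "0 < r'" "i^2 \<in> I_intv r' (r' - k)" for r'
    proof -
      have "r' \<le> j"
        using wedge that by blast
      then show "min r' j = r'" "max r' j = j" "0 \<le> j"
        using that(1) by auto
    qed
    ultimately show "?L \<longleftrightarrow> ?R'"
      unfolding general by (metis (lifting))
  qed
qed

end
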